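(* Let $n$ be a nonnegative integer and $k=12n+4$. Then there is a cyclic subgroup $G$ of $\mathcal O_2(D)$ of order $6$ that (acting by left multiplication on column vectors) acts freely on $\mathcal U_k$; in particular $G$ maps $\mathcal U_k$ to itself. Moreover, $G$ acts on the set of fibers of the map $$\mathfrak c:\mathcal U_k\longrightarrow (\mathbb Z/3\mathbb Z)^2,\quad (x,y)\longmapsto (\overline{2x},\overline{2x+2y}),$$ that is, for every $g\in G$ and every fiber $F$ of $\mathfrak c$, the set $gF$ is again a fiber of $\mathfrak c$.
   Context: For a nonnegative integer $k$, $\mathcal U_k=\{(x,y)\in\mathbb Z^2\mid x^2+3y^2=k\}$. Let $D=\begin{pmatrix}1&0\\0&3\end{pmatrix}$ and $\mathcal O_2(D)=\{Q\in \mathrm{GL}_2(\mathbb R)\mid Q^TDQ=D\}$. Elements of $\mathbb R^2$ are identified with column vectors; $\mathcal O_2(D)$ acts by left multiplication on $\{(x,y)\in\mathbb R^2\mid x^2+3y^2=k\}$, which contains $\mathcal U_k$. For $m\in\mathbb Z$, $\overline m$ is the residue class of $m$ in $\mathbb Z/3\mathbb Z$. A fiber of $\mathfrak c$ is a set $\mathfrak c^{-1}(b)$ with $b$ in the image of $\mathfrak c$. *)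

theory Defs
  imports "HOL-Analysis.Analysis" "HOL-Algebra.Algebra"
begin

definition GL2 :: "(real^2^2) monoid"
  where "GL2 = \<lparr>carrier = {Q. invertible Q}, mult = (**), one = mat 1\<rparr>"

definition D :: "real^2^2"
  where "D = vector [vector [1, 0], vector [0, 3]]"

definition O2 :: "real^2^2 \<Rightarrow> (real^2^2) monoid"
  where "O2 A = GL2\<lparr>carrier := {Q \<in> carrier GL2. transpose Q ** A ** Q = A}\<rparr>"

definition U :: "nat \<Rightarrow> (int^2) set"
  where "U k = {v. (v $ 1)\<^sup>2 + 3 * (v $ 2)\<^sup>2 = int k}"

text \<open>The inclusion of \<open>\<int>\<^sup>2\<close> into \<open>\<real>\<^sup>2\<close>, through which matrices act on integer vectors.\<close>

definition emb :: "int^2 \<Rightarrow> real^2"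
  where "emb v = (\<chi> i. real_of_int (v $ i))"

text \<open>\<open>ZMod 3 m\<close> is the residue class of \<open>m\<close>, an element of the quotient ring \<open>ZFact 3\<close>.\<close>

definition \<cc> :: "int^2 \<Rightarrow> int set \<times> int set"
  where "\<cc> v = (ZMod 3 (2 * v $ 1), ZMod 3 (2 * v $ 1 + 2 * v $ 2))"

text \<open>Only points of the image of \<open>A\<close> are used, so every fiber is nonempty.\<close>

definition fibers :: "('a \<Rightarrow> 'b) \<Rightarrow> 'a set \<Rightarrow> 'a set set"
  where "fibers f A = {{x \<in> A. f x = b} | b. b \<in> f ` A}"

locale free_action = group_action +
  assumes free: "\<lbrakk>g \<in> carrier G; x \<in> E; \<phi> g x = x\<rbrakk> \<Longrightarrow> g = \<one>"

lemma group_GL2: "group GL2"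
proof (rule groupI)
  fix Q assume "Q \<in> carrier GL2"
  then obtain P where "Q ** P = mat 1" "P ** Q = mat 1"
    by (auto simp: GL2_def invertible_def)
  then have "P \<in> carrier GL2" "P \<otimes>\<^bsub>GL2\<^esub> Q = \<one>\<^bsub>GL2\<^esub>"
    by (auto simp: GL2_def invertible_def)
  then show "\<exists>P\<in>carrier GL2. P \<otimes>\<^bsub>GL2\<^esub> Q = \<one>\<^bsub>GL2\<^esub>" by blast
qed (auto simp: GL2_def invertible_mult matrix_mul_assoc invertible_def[of "mat 1"] intro: exI[of _ "mat 1"])

lemma subgroup_O2: "subgroup (carrier (O2 A)) GL2"
proof (rule group.subgroupI[OF group_GL2])
  show "carrier (O2 A) \<subseteq> carrier GL2" by (auto simp: O2_def)
  have "mat 1 \<in> carrier (O2 A)"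
    using group.is_monoid[OF group_GL2, THEN monoid.one_closed]
    by (simp add: O2_def GL2_def transpose_mat)
  then show "carrier (O2 A) \<noteq> {}" by blast
next
  fix Q assume "Q \<in> carrier (O2 A)"
  then have Q: "Q \<in> carrier GL2" "transpose Q ** A ** Q = A" by (auto simp: O2_def)
  define P where "P = inv\<^bsub>GL2\<^esub> Q"
  have P: "P \<in> carrier GL2" "Q ** P = mat 1"
    using group.inv_closed[OF group_GL2 Q(1)] group.r_inv[OF group_GL2 Q(1)]
    by (auto simp: P_def GL2_def)
  have "transpose P ** A ** P = transpose P ** (transpose Q ** A ** Q) ** P"
    by (simp add: Q(2))
  also have "\<dots> = transpose (Q ** P) ** A ** (Q ** P)"
    by (simp add: matrix_transpose_mul matrix_mul_assoc)
  finally show "inv\<^bsub>GL2\<^esub> Q \<in> carrier (O2 A)"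
    using P by (simp add: O2_def P_def transpose_mat)
next
  fix Q R assume "Q \<in> carrier (O2 A)" "R \<in> carrier (O2 A)"
  then have *: "Q \<in> carrier GL2" "R \<in> carrier GL2"
      "transpose Q ** A ** Q = A" "transpose R ** A ** R = A" by (auto simp: O2_def)
  have "transpose (Q ** R) ** A ** (Q ** R) = transpose R ** (transpose Q ** A ** Q) ** R"
    by (simp add: matrix_transpose_mul matrix_mul_assoc)
  then show "Q \<otimes>\<^bsub>GL2\<^esub> R \<in> carrier (O2 A)"
    using * by (simp add: O2_def GL2_def invertible_mult)
qed

lemma group_O2: "group (O2 A)"
  using subgroup.subgroup_is_group[OF subgroup_O2 group_GL2, of A] by (simp add: O2_def)

end

theory Submission
  imports Defs
begin

text \<open>
  Identify \<open>(x, y)\<close> with the complex number \<open>x + y \<surd>-3\<close>, so that \<open>x\<^sup>2 + 3 y\<^sup>2\<close> is the squared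
  modulus.  Multiplication by a number of modulus one then preserves the form, and the sixth root
  of unity \<open>(1 + \<surd>-3) / 2\<close> yields a matrix of order 6, the group being the set of its powers.  The action
  is free because every power is again multiplication by a number \<open>z\<close>, and \<open>z v = v\<close> with \<open>v \<noteq> 0\<close>
  forces \<open>z = 1\<close>; here \<open>0 \<notin> \<U>\<^sub>k\<close> since \<open>k > 0\<close>.

  The rotation sends \<open>(x, y)\<close> to \<open>((x - 3 y) / 2, (x + y) / 2)\<close>.  Since \<open>k\<close> is even, \<open>x\<close> and \<open>y\<close> have
  the same parity on \<open>\<U>\<^sub>k\<close>, so the image is again integral (lemmas \<open>same_parity_U\<close> and
  \<open>bij_betw_rotate_int_U\<close>).  As \<open>1 / 2\<close> is \<open>-1\<close> modulo 3, the rotation reduces modulo 3 to the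
  linear map \<open>(x, y) \<mapsto> (-x, -x - y)\<close>, which is invertible.  Since \<open>\<cc>\<close> records exactly the residues of
  \<open>x\<close> and \<open>y\<close>, the rotation permutes the fibers (lemmas \<open>\<cc>_rotate_int_eq_iff\<close> and
  \<open>image_in_fibers\<close>), and so do its powers.
\<close>

section \<open>Group actions and fibers\<close>

text \<open>
  The action laws on \<open>E\<close> suffice: bijectivity of each \<open>\<phi> g\<close> comes from the inverse of \<open>g\<close>.
\<close>

lemma group_actionI:
  assumes "group K"
    and closed: "\<And>g x. g \<in> carrier K \<Longrightarrow> x \<in> E \<Longrightarrow> \<phi> g x \<in> E"
    and one: "\<And>x. x \<in> E \<Longrightarrow> \<phi> \<one>\<^bsub>K\<^esub> x = x"
    and mult: "\<And>g h x. g \<in> carrier K \<Longrightarrow> h \<in> carrier K \<Longrightarrow> x \<in> E \<Longrightarrow> \<phi> (g \<otimes>\<^bsub>K\<^esub> h) x = \<phi> g (\<phi> h x)"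
  shows "group_action K E (\<lambda>g. \<lambda>x\<in>E. \<phi> g x)"
proof -
  interpret K: group K by fact
  have bij: "(\<lambda>x\<in>E. \<phi> g x) \<in> Bij E" if g: "g \<in> carrier K" for g
  proof -
    have "bij_betw (\<phi> g) E E"
    proof (rule bij_betw_byWitness[where f' = "\<phi> (inv\<^bsub>K\<^esub> g)"])
      show "\<forall>x\<in>E. \<phi> (inv\<^bsub>K\<^esub> g) (\<phi> g x) = x"
        using mult[of "inv\<^bsub>K\<^esub> g" g] g one by simp
      show "\<forall>x\<in>E. \<phi> g (\<phi> (inv\<^bsub>K\<^esub> g) x) = x"
        using mult[of g "inv\<^bsub>K\<^esub> g"] g one by simp
    qed (use closed g in auto)
    then show ?thesis by (simp add: Bij_def)
  qed
  have "(\<lambda>g. \<lambda>x\<in>E. \<phi> g x) \<in> hom K (BijGroup E)"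
  proof (rule homI)
    fix g h assume gh: "g \<in> carrier K" "h \<in> carrier K"
    show "(\<lambda>x\<in>E. \<phi> (g \<otimes>\<^bsub>K\<^esub> h) x) = (\<lambda>x\<in>E. \<phi> g x) \<otimes>\<^bsub>BijGroup E\<^esub> (\<lambda>x\<in>E. \<phi> h x)"
      using gh bij by (auto simp: BijGroup_def compose_def mult closed)
  qed (use bij in \<open>simp add: BijGroup_def\<close>)
  then show ?thesis
    by (simp add: group_action_def group_hom_def group_hom_axioms_def group_BijGroup \<open>group K\<close>)
qed

lemma image_in_fibers:
  assumes r: "bij_betw r A A"
    and f: "\<And>v w. v \<in> A \<Longrightarrow> w \<in> A \<Longrightarrow> f (r v) = f (r w) \<longleftrightarrow> f v = f w"
    and F: "F \<in> fibers f A"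
  shows "r ` F \<in> fibers f A"
proof -
  from F obtain w where w: "w \<in> A" "F = {x \<in> A. f x = f w}"
    by (auto simp: fibers_def)
  have A: "r ` A = A" using r by (simp add: bij_betw_def)
  have "r ` F = {x \<in> r ` A. f x = f (r w)}"
    using w f by auto
  moreover have "r w \<in> A" using A w by blast
  ultimately show ?thesis
    unfolding fibers_def A by blast
qed

section \<open>The rotation of order six\<close>

text \<open>The matrix of multiplication by \<open>a + b \<surd>-3\<close> in the basis \<open>1, \<surd>-3\<close>.\<close>

definition mult_matrix :: "real \<Rightarrow> real \<Rightarrow> real^2^2"
  where "mult_matrix a b = vector [vector [a, - 3 * b], vector [b, a]]"

abbreviation rotation :: "real^2^2"
  where "rotation \<equiv> mult_matrix (1/2) (1/2)"

lemma mult_matrix_mult: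
  "mult_matrix a b ** mult_matrix c d = mult_matrix (a * c - 3 * b * d) (a * d + b * c)"
  by (simp add: mult_matrix_def vec_eq_iff forall_2 matrix_matrix_mult_def sum_2 algebra_simps)

lemma mat_1_eq_mult_matrix: "mat 1 = mult_matrix 1 0"
  by (simp add: mult_matrix_def vec_eq_iff forall_2 mat_def)

lemma mult_matrix_inject: "mult_matrix a b = mult_matrix c d \<longleftrightarrow> a = c \<and> b = d"
  by (auto simp: mult_matrix_def vec_eq_iff forall_2)

lemma mult_matrix_vector:
  "mult_matrix a b *v v = vector [a * v $ 1 - 3 * b * v $ 2, b * v $ 1 + a * v $ 2]"
  by (simp add: mult_matrix_def vec_eq_iff forall_2 matrix_vector_mult_def sum_2)

lemma mult_matrix_in_O2:
  assumes "a\<^sup>2 + 3 * b\<^sup>2 = 1"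
  shows "mult_matrix a b \<in> carrier (O2 D)"
proof -
  \<comment> \<open>The inverse of a number of norm one is its conjugate.\<close>
  have "mult_matrix a b ** mult_matrix a (- b) = mat 1"
    "mult_matrix a (- b) ** mult_matrix a b = mat 1"
    using assms
    by (simp_all add: mult_matrix_mult mat_1_eq_mult_matrix mult_matrix_inject power2_eq_square
        algebra_simps)
  then have "invertible (mult_matrix a b)"
    unfolding invertible_def by blast
  moreover have "transpose (mult_matrix a b) ** D ** mult_matrix a b = D"
    using assms
    by (simp add: mult_matrix_def D_def vec_eq_iff forall_2 matrix_matrix_mult_def transpose_def
        sum_2 power2_eq_square algebra_simps)
  ultimately show ?thesis
    by (simp add: O2_def GL2_def)
qed

text \<open>
  If \<open>z v = v\<close>, then \<open>z - 1\<close> kills \<open>v\<close>, so the product of the norms of \<open>z - 1\<close> and of \<open>v\<close> is zero.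
\<close>

lemma mult_matrix_fixes_nonzero:
  assumes fix_v: "mult_matrix a b *v v = v" and "v \<noteq> 0"
  shows "mult_matrix a b = mat 1"
proof -
  define x y where "x = v $ 1" and "y = v $ 2"
  have eqs: "(a - 1) * x - 3 * b * y = 0" "b * x + (a - 1) * y = 0"
    using fix_v by (simp_all add: mult_matrix_vector vec_eq_iff forall_2 x_def y_def algebra_simps)
  have "((a - 1)\<^sup>2 + 3 * b\<^sup>2) * (x\<^sup>2 + 3 * y\<^sup>2)
      = ((a - 1) * x - 3 * b * y)\<^sup>2 + 3 * (b * x + (a - 1) * y)\<^sup>2"
    by (simp add: power2_eq_square algebra_simps)
  also have "\<dots> = 0" by (simp add: eqs)
  finally have "(a - 1)\<^sup>2 + 3 * b\<^sup>2 = 0 \<or> x\<^sup>2 + 3 * y\<^sup>2 = 0" by simp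
  moreover have "x \<noteq> 0 \<or> y \<noteq> 0"
    using \<open>v \<noteq> 0\<close> by (auto simp: vec_eq_iff forall_2 x_def y_def)
  then have "x\<^sup>2 + 3 * y\<^sup>2 \<noteq> 0"
    by (simp add: add_nonneg_eq_0_iff)
  ultimately have "a = 1" "b = 0"
    by (auto simp: add_nonneg_eq_0_iff)
  then show ?thesis by (simp add: mat_1_eq_mult_matrix)
qed

lemma mult_O2 [simp]: "P \<otimes>\<^bsub>O2 A\<^esub> Q = P ** Q"
  by (simp add: O2_def GL2_def)

lemma one_O2 [simp]: "\<one>\<^bsub>O2 A\<^esub> = mat 1"
  by (simp add: O2_def GL2_def)

lemma rotation_in_O2: "rotation \<in> carrier (O2 D)"
  by (rule mult_matrix_in_O2) (simp add: power2_eq_square)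

lemma ord_rotation: "group.ord (O2 D) rotation = 6"
proof -
  interpret group "O2 D" by (rule group_O2)
  have pow: "rotation [^]\<^bsub>O2 D\<^esub> (2::nat) = mult_matrix (-1/2) (1/2)"
    "rotation [^]\<^bsub>O2 D\<^esub> (3::nat) = mult_matrix (-1) 0"
    "rotation [^]\<^bsub>O2 D\<^esub> (6::nat) = mat 1"
    by (simp_all add: numeral_eq_Suc mult_matrix_mult mat_1_eq_mult_matrix)
  have "ord rotation dvd 6" "\<not> ord rotation dvd 2" "\<not> ord rotation dvd 3"
    using rotation_in_O2
    by (simp_all flip: pow_eq_id add: pow mat_1_eq_mult_matrix mult_matrix_inject)
  moreover have "ord rotation \<le> 6"
    using calculation(1) by (rule dvd_imp_le) simp
  then have "ord rotation \<in> {0, 1, 2, 3, 4, 5, 6}"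
    by auto
  ultimately show ?thesis by auto
qed

section \<open>The rotation on integral points\<close>

text \<open>
  The rotation in integer coordinates; the divisions are exact when the coordinates of \<open>v\<close> have
  the same parity.
\<close>

definition rotate_int :: "int^2 \<Rightarrow> int^2"
  where "rotate_int v = vector [(v $ 1 - 3 * v $ 2) div 2, (v $ 1 + v $ 2) div 2]"

text \<open>The inverse rotation: multiplication by the conjugate \<open>(1 - \<surd>-3) / 2\<close>.\<close>

definition unrotate_int :: "int^2 \<Rightarrow> int^2"
  where "unrotate_int v = vector [(v $ 1 + 3 * v $ 2) div 2, (v $ 2 - v $ 1) div 2]"

lemma same_parity_U:
  assumes "even k" "v \<in> U k"
  obtains t where "v $ 1 = v $ 2 + 2 * t"
proof -
  have "even ((v $ 1)\<^sup>2 + 3 * (v $ 2)\<^sup>2)"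
    using assms by (simp add: U_def)
  then have "even (v $ 1 - v $ 2)" by simp
  then obtain t where "v $ 1 - v $ 2 = 2 * t" by blast
  then show ?thesis by (intro that[of t]) simp
qed

text \<open>
  Writing \<open>x = y + 2 t\<close> removes the divisions from both rotations.
\<close>

lemma rotate_int_coords:
  assumes "v $ 1 = v $ 2 + 2 * t"
  shows "rotate_int v $ 1 = t - v $ 2" "rotate_int v $ 2 = t + v $ 2"
    "unrotate_int v $ 1 = 2 * v $ 2 + t" "unrotate_int v $ 2 = - t"
  using assms by (auto simp: rotate_int_def unrotate_int_def)

lemma bij_betw_rotate_int_U:
  assumes "even k"
  shows "bij_betw rotate_int (U k) (U k)"
proof (rule bij_betw_byWitness[where f' = unrotate_int])
  show "\<forall>v\<in>U k. unrotate_int (rotate_int v) = v"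
  proof
    fix v assume "v \<in> U k"
    then obtain t where t: "v $ 1 = v $ 2 + 2 * t" using same_parity_U[OF assms] by blast
    have "rotate_int v $ 1 = rotate_int v $ 2 + 2 * (- v $ 2)" by (simp add: rotate_int_coords[OF t])
    from rotate_int_coords[OF this] show "unrotate_int (rotate_int v) = v"
      by (simp add: vec_eq_iff forall_2 rotate_int_coords[OF t] t)
  qed
  show "\<forall>v\<in>U k. rotate_int (unrotate_int v) = v"
  proof
    fix v assume "v \<in> U k"
    then obtain t where t: "v $ 1 = v $ 2 + 2 * t" using same_parity_U[OF assms] by blast
    have "unrotate_int v $ 1 = unrotate_int v $ 2 + 2 * (v $ 2 + t)" by (simp add: rotate_int_coords[OF t])
    from rotate_int_coords[OF this] show "rotate_int (unrotate_int v) = v"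
      by (simp add: vec_eq_iff forall_2 rotate_int_coords[OF t] t)
  qed
  have "rotate_int v \<in> U k \<and> unrotate_int v \<in> U k" if v: "v \<in> U k" for v
  proof -
    obtain t where t: "v $ 1 = v $ 2 + 2 * t" using same_parity_U[OF assms v] .
    show ?thesis
      using v by (simp add: U_def rotate_int_coords[OF t] t power2_eq_square algebra_simps)
  qed
  then show "rotate_int ` U k \<subseteq> U k" "unrotate_int ` U k \<subseteq> U k" by auto
qed

lemma emb_rotate_int:
  assumes "even k" "v \<in> U k"
  shows "rotation *v emb v = emb (rotate_int v)"
proof -
  obtain t where t: "v $ 1 = v $ 2 + 2 * t" using same_parity_U[OF assms] .
  show ?thesis
    by (simp add: mult_matrix_vector emb_def vec_eq_iff forall_2 rotate_int_coords[OF t] t field_simps)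
qed

text \<open>
  Since 2 is a unit modulo 3, \<open>\<cc>\<close> is an invertible linear map applied to the residues of the
  coordinates.
\<close>

lemma \<cc>_eq_iff: "\<cc> v = \<cc> w \<longleftrightarrow> 3 dvd v $ 1 - w $ 1 \<and> 3 dvd v $ 2 - w $ 2"
proof -
  have "3 dvd 2 * a \<and> 3 dvd 2 * a + 2 * b \<longleftrightarrow> 3 dvd a \<and> 3 dvd b" for a b :: int
    by presburger
  from this[of "v $ 1 - w $ 1" "v $ 2 - w $ 2"] show ?thesis
    by (simp add: \<cc>_def ZMod_eq_mod mod_eq_dvd_iff algebra_simps)
qed

text \<open>
  The rotation acts on residues modulo 3 by \<open>(x, y) \<mapsto> (-x, -x - y)\<close>, so the residues before and
  after it determine each other.
\<close>

lemma \<cc>_rotate_int_eq_iff: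
  assumes "even k" "v \<in> U k" "w \<in> U k"
  shows "\<cc> (rotate_int v) = \<cc> (rotate_int w) \<longleftrightarrow> \<cc> v = \<cc> w"
proof -
  obtain s where s: "v $ 1 = v $ 2 + 2 * s" using same_parity_U[OF assms(1,2)] .
  obtain t where t: "w $ 1 = w $ 2 + 2 * t" using same_parity_U[OF assms(1,3)] .
  have "3 dvd a - b \<and> 3 dvd a + b \<longleftrightarrow> 3 dvd b + 2 * a \<and> 3 dvd b" for a b :: int
    by presburger
  from this[of "s - t" "v $ 2 - w $ 2"] show ?thesis
    by (simp add: \<cc>_eq_iff rotate_int_coords[OF s] rotate_int_coords[OF t] s t algebra_simps)
qed

lemma rotation_image_fiber:
  assumes "even k" "F \<in> (`) emb ` fibers \<cc> (U k)"
  shows "(*v) rotation ` F \<in> (`) emb ` fibers \<cc> (U k)"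
proof -
  from assms(2) obtain F' where F': "F' \<in> fibers \<cc> (U k)" "F = emb ` F'" by blast
  then have "F' \<subseteq> U k" by (auto simp: fibers_def)
  then have "(*v) rotation ` F = emb ` rotate_int ` F'"
    using emb_rotate_int[OF assms(1)] by (force simp: F'(2) image_image)
  moreover have "rotate_int ` F' \<in> fibers \<cc> (U k)"
    using bij_betw_rotate_int_U[OF assms(1)] \<cc>_rotate_int_eq_iff[OF assms(1)] F'(1)
    by (rule image_in_fibers)
  ultimately show ?thesis by blast
qed

section \<open>The cyclic group and its two actions\<close>

text \<open>
  A cyclic group of finite order consists of the nonnegative powers of its generator, so whatever
  the identity satisfies and left multiplication by the rotation preserves holds on the whole group.
\<close>

lemma generate_rotation_induct [consumes 1, case_names one step]:
  assumes "g \<in> generate (O2 D) {rotation}"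
    and "P (mat 1)" and "\<And>g. P g \<Longrightarrow> P (rotation ** g)"
  shows "P g"
proof -
  interpret group "O2 D" by (rule group_O2)
  obtain i :: nat where i: "g = rotation [^]\<^bsub>O2 D\<^esub> i"
    using assms(1) generate_pow_nat[OF rotation_in_O2] by (auto simp: ord_rotation)
  have "P (rotation [^]\<^bsub>O2 D\<^esub> i)" for i :: nat
  proof (induction i)
    case (Suc i)
    then show ?case
      using nat_pow_Suc2[OF rotation_in_O2] assms(3) by simp
  qed (use assms(2) in simp)
  then show ?thesis by (simp add: i)
qed

theorem theorem2p1:
  fixes n k :: nat
  assumes "k = 12 * n + 4"
  shows "\<exists>G. subgroup G (O2 D)
    \<and> cyclic_group (O2 D\<lparr>carrier := G\<rparr>)
    \<and> order (O2 D\<lparr>carrier := G\<rparr>) = 6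
    \<and> free_action (O2 D\<lparr>carrier := G\<rparr>) (emb ` U k) (\<lambda>g. \<lambda>v \<in> emb ` U k. g *v v)
    \<and> group_action (O2 D\<lparr>carrier := G\<rparr>) ((`) emb ` fibers \<cc> (U k))
        (\<lambda>g. \<lambda>F \<in> (`) emb ` fibers \<cc> (U k). (*v) g ` F)
    \<and> (\<forall>g\<in>G. \<forall>F \<in> (`) emb ` fibers \<cc> (U k). (*v) g ` F \<in> (`) emb ` fibers \<cc> (U k))"
proof -
  interpret O2: group "O2 D" by (rule group_O2)
  define G where "G = generate (O2 D) {rotation}"
  let ?K = "O2 D\<lparr>carrier := G\<rparr>"
  have k: "even k" "k > 0" using assms by auto
  have sub: "subgroup G (O2 D)"
    unfolding G_def using rotation_in_O2 by (intro O2.generate_is_subgroup) simp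
  then have grp: "group ?K"
    by (rule O2.subgroup_imp_group)
  have "cyclic_group ?K"
    using O2.cyclic_group_generated[of rotation] rotation_in_O2
    by (simp add: subgroup_generated_def G_def)
  moreover have "order ?K = 6"
    using O2.generate_pow_card[OF rotation_in_O2] by (simp add: order_def G_def ord_rotation)
  moreover have "free_action ?K (emb ` U k) (\<lambda>g. \<lambda>v \<in> emb ` U k. g *v v)"
  proof -
    have "g *v v \<in> emb ` U k" if "g \<in> G" "v \<in> emb ` U k" for g v
      using that(1) unfolding G_def
    proof (induction rule: generate_rotation_induct)
      case (step g)
      then obtain w where w: "w \<in> U k" "g *v v = emb w" by blast
      then have "(rotation ** g) *v v = emb (rotate_int w)"
        by (simp add: emb_rotate_int[OF k(1)] flip: matrix_vector_mul_assoc)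
      moreover have "rotate_int w \<in> U k"
        using bij_betw_rotate_int_U[OF k(1)] w(1) by (auto simp: bij_betw_def)
      ultimately show ?case by blast
    qed (use that(2) in simp)
    then have "group_action ?K (emb ` U k) (\<lambda>g. \<lambda>v \<in> emb ` U k. g *v v)"
      by (intro group_actionI[OF grp]) (simp_all add: matrix_vector_mul_assoc)
    moreover have "g = mat 1" if g: "g \<in> G" and v: "v \<in> emb ` U k" "g *v v = v" for g v
    proof -
      have "\<exists>a b. g = mult_matrix a b"
        using g unfolding G_def
        by (induction rule: generate_rotation_induct)
          (use mat_1_eq_mult_matrix mult_matrix_mult in blast)+
      moreover have "v \<noteq> 0"
        using v(1) k(2) by (auto simp: U_def emb_def vec_eq_iff forall_2)
      ultimately show ?thesis using mult_matrix_fixes_nonzero v(2) by blast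
    qed
    ultimately show ?thesis
      by (auto simp: free_action_def free_action_axioms_def)
  qed
  moreover have fib: "(*v) g ` F \<in> (`) emb ` fibers \<cc> (U k)"
    if "g \<in> G" "F \<in> (`) emb ` fibers \<cc> (U k)" for g F
    using that(1) unfolding G_def
  proof (induction rule: generate_rotation_induct)
    case (step g)
    have "(*v) (rotation ** g) ` F = (*v) rotation ` (*v) g ` F"
      by (simp add: image_image matrix_vector_mul_assoc)
    then show ?case using rotation_image_fiber[OF k(1) step] by simp
  qed (use that(2) in simp)
  moreover have "group_action ?K ((`) emb ` fibers \<cc> (U k))
      (\<lambda>g. \<lambda>F \<in> (`) emb ` fibers \<cc> (U k). (*v) g ` F)"
    using fib by (intro group_actionI[OF grp]) (simp_all add: image_image matrix_vector_mul_assoc)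
  ultimately show ?thesis using sub by blast
qed

end
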